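(* Let $b_{ij,k}$ ($i,j,k\in\{1,2,3\}$) be real numbers such that $V(\mathbf f)_k=\sum_{i,j=1}^3 b_{ij,k}f_if_j$ ($k=1,2,3$) defines a map $V:S\to S$, and put $\delta_k=\sum_{i,j=1}^3|b_{ij,k}|$. Assume that $$\sum_{i,j=1}^3|b_{ij,k}|\le 1,\qquad k=1,2,3 .$$ If there is $k_0\in\{1,2,3\}$ such that $\delta_{k_0}<1$ and for each $k=1,2,3$ one can find $i_0\in\{1,2,3\}$ with $|b_{i_0k_0,k}|+|b_{k_0i_0,k}|\ne 0$, then $(0,0,0)$ is a unique stable fixed point of $V$, i.e. for every $\mathbf f\in S$ one has $V^n(\mathbf f)\to(0,0,0)$ as $n\to\infty$.
   Context: $S=\{\mathbf p\in\mathbb{R}^3: p_1^2+p_2^2+p_3^2\le 1\}$ is the closed Euclidean unit ball. $V^n$ denotes the $n$-th iterate of $V$. *)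

theory Defs
  imports "HOL-Analysis.Analysis"
begin

text \<open>The coefficient \<open>b\<^sub>i\<^sub>j\<^sub>,\<^sub>k\<close> is written \<open>b i j k\<close>.
  The index type \<open>3\<close> has exactly the elements \<open>1, 2, 3\<close> (with \<open>3 = 0\<close>).\<close>

definition quad_map :: "(3 \<Rightarrow> 3 \<Rightarrow> 3 \<Rightarrow> real) \<Rightarrow> real ^ 3 \<Rightarrow> real ^ 3" where
  "quad_map b f = (\<chi> k. \<Sum>i\<in>UNIV. \<Sum>j\<in>UNIV. b i j k * f $ i * f $ j)"

definition delta :: "(3 \<Rightarrow> 3 \<Rightarrow> 3 \<Rightarrow> real) \<Rightarrow> 3 \<Rightarrow> real" where
  "delta b k = (\<Sum>i\<in>UNIV. \<Sum>j\<in>UNIV. \<bar>b i j k\<bar>)"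

abbreviation unit_ball3 :: "(real ^ 3) set" where
  "unit_ball3 \<equiv> cball 0 1"

end

theory Submission
  imports Defs
begin

text \<open>In the supremum norm \<open>V\<close> satisfies \<open>|V f| \<le> |f|\<^sup>2\<close>, since all \<open>\<delta>\<^sub>k \<le> 1\<close>. On the unit
  cube the first application of \<open>V\<close> pushes the \<open>k0\<close>-th coordinate below \<open>\<delta>\<^sub>k\<^sub>0 < 1\<close>; as this
  coordinate enters every component of \<open>V\<close>, the second application pushes the whole norm
  below some \<open>q < 1\<close>, uniformly. From then on each step shrinks the norm by the factor \<open>q\<close>.\<close>

lemma abs_quad_map_le:
  "\<bar>quad_map b f $ k\<bar> \<le> (\<Sum>i\<in>UNIV. \<Sum>j\<in>UNIV. \<bar>b i j k\<bar> * (\<bar>f $ i\<bar> * \<bar>f $ j\<bar>))"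
proof -
  have "\<bar>quad_map b f $ k\<bar> \<le> (\<Sum>i\<in>UNIV. \<bar>\<Sum>j\<in>UNIV. b i j k * f $ i * f $ j\<bar>)"
    unfolding quad_map_def by simp
  also have "\<dots> \<le> (\<Sum>i\<in>UNIV. \<Sum>j\<in>UNIV. \<bar>b i j k * f $ i * f $ j\<bar>)"
    by (intro sum_mono sum_abs)
  finally show ?thesis by (simp add: abs_mult mult.assoc)
qed

lemma abs_quad_map_le_delta:
  assumes "\<And>i. \<bar>f $ i\<bar> \<le> m"
  shows "\<bar>quad_map b f $ k\<bar> \<le> delta b k * m\<^sup>2"
proof -
  have "\<bar>f $ i\<bar> * \<bar>f $ j\<bar> \<le> m\<^sup>2" for i j
    unfolding power2_eq_square using assms[of i] assms[of j] by (intro mult_mono) auto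
  then have "(\<Sum>i\<in>UNIV. \<Sum>j\<in>UNIV. \<bar>b i j k\<bar> * (\<bar>f $ i\<bar> * \<bar>f $ j\<bar>))
      \<le> (\<Sum>i\<in>UNIV. \<Sum>j\<in>UNIV. \<bar>b i j k\<bar> * m\<^sup>2)"
    by (intro sum_mono mult_left_mono) auto
  with abs_quad_map_le[of b f k] show ?thesis
    by (simp add: delta_def sum_distrib_right)
qed

text \<open>The gap between \<open>delta b k\<close> and the triangle-inequality bound is a sum of
  nonnegative terms \<open>?u i' j'\<close>. Already the single term at \<open>(i, j)\<close> is at
  least \<open>(1 - d) * \<bar>b i j k\<bar>\<close>, since one factor of its product is the
  \<open>k0\<close>-th coordinate and the other is at most 1.\<close>

lemma abs_quad_map_le_delta_minus:
  assumes f: "\<And>i. \<bar>f $ i\<bar> \<le> 1" and d: "\<bar>f $ k0\<bar> \<le> d" and ij: "i = k0 \<or> j = k0"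
  shows "\<bar>quad_map b f $ k\<bar> \<le> delta b k - (1 - d) * \<bar>b i j k\<bar>"
proof -
  let ?u = "\<lambda>i' j'. \<bar>b i' j' k\<bar> * (1 - \<bar>f $ i'\<bar> * \<bar>f $ j'\<bar>)"
  have nonneg: "0 \<le> ?u i' j'" for i' j'
    using f[of i'] f[of j'] by (simp add: mult_le_one)
  have "\<bar>f $ i\<bar> * \<bar>f $ j\<bar> \<le> d"
    using ij d f[of i] f[of j] mult_mono[of "\<bar>f $ i\<bar>" 1 "\<bar>f $ j\<bar>" d]
      mult_mono[of "\<bar>f $ i\<bar>" d "\<bar>f $ j\<bar>" 1] by auto
  then have "\<bar>b i j k\<bar> * (1 - d) \<le> ?u i j"
    by (intro mult_left_mono) auto
  also have "\<dots> \<le> (\<Sum>j'\<in>UNIV. ?u i j')"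
    using nonneg by (intro member_le_sum) auto
  also have "\<dots> \<le> (\<Sum>i'\<in>UNIV. \<Sum>j'\<in>UNIV. ?u i' j')"
    using nonneg by (intro member_le_sum[of i UNIV "\<lambda>i'. \<Sum>j'\<in>UNIV. ?u i' j'"] sum_nonneg) auto
  also have "\<dots> = delta b k - (\<Sum>i\<in>UNIV. \<Sum>j\<in>UNIV. \<bar>b i j k\<bar> * (\<bar>f $ i\<bar> * \<bar>f $ j\<bar>))"
    by (simp add: delta_def right_diff_distrib sum_subtractf)
  finally show ?thesis
    using abs_quad_map_le[of b f k] by (simp add: mult.commute)
qed

text \<open>Each step squares the bound, and \<open>2 * Suc n \<ge> Suc (Suc n)\<close> with
  \<open>q \<le> 1\<close> weakens this to one more factor \<open>q\<close>. The exponent is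
  \<open>Suc n\<close> because \<open>g\<close> itself is already bounded by
  \<open>q\<close>.\<close>

lemma quad_map_funpow_contraction:
  assumes del: "\<And>k. delta b k \<le> 1" and q: "0 \<le> q" "q \<le> 1" and g: "\<And>k. \<bar>g $ k\<bar> \<le> q"
  shows "\<bar>(quad_map b ^^ n) g $ k\<bar> \<le> q ^ Suc n"
proof (induction n arbitrary: k)
  case 0
  then show ?case using g by simp
next
  case (Suc n)
  have "\<bar>quad_map b ((quad_map b ^^ n) g) $ k\<bar> \<le> delta b k * (q ^ Suc n)\<^sup>2"
    using Suc by (rule abs_quad_map_le_delta)
  also have "\<dots> \<le> (q ^ Suc n)\<^sup>2"
    using del[of k] by (simp add: mult_left_le_one_le delta_def sum_nonneg)
  also have "\<dots> \<le> q ^ Suc (Suc n)"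
    unfolding power_mult[symmetric] using q by (intro power_decreasing) auto
  finally show ?case by simp
qed

text \<open>The point is uniformity: \<open>q\<close> is fixed before \<open>f\<close> and
  \<open>k\<close>, which works because only finitely many components \<open>k\<close>
  occur.\<close>

lemma quad_map_two_steps:
  assumes del: "\<And>k. delta b k \<le> 1" and k0: "delta b k0 < 1"
    and ex: "\<And>k. \<exists>i. \<bar>b i k0 k\<bar> + \<bar>b k0 i k\<bar> \<noteq> 0"
  obtains q where "0 \<le> q" "q < 1"
    "\<And>f k. (\<And>i. \<bar>f $ i\<bar> \<le> 1) \<Longrightarrow> \<bar>quad_map b (quad_map b f) $ k\<bar> \<le> q"
proof -
  have "\<exists>i j. (i = k0 \<or> j = k0) \<and> b i j k \<noteq> 0" for k
    using ex[of k] by (metis abs_zero add.right_neutral)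
  then obtain I J where IJ: "\<And>k. I k = k0 \<or> J k = k0" "\<And>k. b (I k) (J k) k \<noteq> 0"
    by metis
  \<comment> \<open>This is the bound of \<open>abs_quad_map_le_delta_minus\<close> with
    \<open>d = delta b k0\<close>, the value that the first application of the map guarantees at
    coordinate \<open>k0\<close>.\<close>
  define r where "r k = delta b k - (1 - delta b k0) * \<bar>b (I k) (J k) k\<bar>" for k
  \<comment> \<open>Inserting 0 yields \<open>0 \<le> q\<close> at once.\<close>
  define q where "q = Max (insert 0 (range r))"
  have r1: "r k < 1" for k
  proof -
    have "0 < (1 - delta b k0) * \<bar>b (I k) (J k) k\<bar>"
      using k0 IJ(2)[of k] by (intro mult_pos_pos) auto
    with del[of k] show ?thesis unfolding r_def by linarith
  qed
  have rq: "r k \<le> q" for k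
    unfolding q_def by (rule Max_ge) auto
  have "0 \<le> q" "q < 1"
    using r1 unfolding q_def by auto
  moreover have "\<bar>quad_map b (quad_map b f) $ k\<bar> \<le> q" if f: "\<And>i. \<bar>f $ i\<bar> \<le> 1" for f k
  proof -
    have 1: "\<bar>quad_map b f $ i\<bar> \<le> delta b i" for i
      using abs_quad_map_le_delta[OF f] by simp
    then have "\<bar>quad_map b f $ i\<bar> \<le> 1" for i
      using del order_trans by blast
    then have "\<bar>quad_map b (quad_map b f) $ k\<bar> \<le> r k"
      unfolding r_def using 1 IJ(1) by (rule abs_quad_map_le_delta_minus)
    with rq show ?thesis by (rule order_trans[rotated])
  qed
  ultimately show ?thesis using that by blast
qed

theorem theorem4p8:
  fixes b :: "3 \<Rightarrow> 3 \<Rightarrow> 3 \<Rightarrow> real" and k0 :: 3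
  assumes "quad_map b ` unit_ball3 \<subseteq> unit_ball3"
    and "\<And>k. delta b k \<le> 1"
    and "delta b k0 < 1"
    and "\<And>k. \<exists>i0. \<bar>b i0 k0 k\<bar> + \<bar>b k0 i0 k\<bar> \<noteq> 0"
  shows "quad_map b 0 = 0
    \<and> (\<forall>f\<in>unit_ball3. quad_map b f = f \<longrightarrow> f = 0)
    \<and> (\<forall>f\<in>unit_ball3. (\<lambda>n. (quad_map b ^^ n) f) \<longlonglongrightarrow> 0)"
proof -
  obtain q where q: "0 \<le> q" "q < 1"
    and two: "\<And>f k. (\<And>i. \<bar>f $ i\<bar> \<le> 1) \<Longrightarrow> \<bar>quad_map b (quad_map b f) $ k\<bar> \<le> q"
    using quad_map_two_steps[OF assms(2-4)] by blast
  have lim: "(\<lambda>n. (quad_map b ^^ n) f) \<longlonglongrightarrow> 0" if "f \<in> unit_ball3" for f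
  proof -
    \<comment> \<open>The Euclidean ball lies in the unit cube, where the supremum-norm estimates
      apply.\<close>
    have "\<bar>f $ i\<bar> \<le> 1" for i
      using that component_le_norm_cart[of f i] by simp
    then have g: "\<bar>quad_map b (quad_map b f) $ k\<bar> \<le> q" for k
      by (rule two)
    \<comment> \<open>The orbit is followed from its second iterate on, the first one known to be
      bounded by \<open>q\<close>; \<open>LIMSEQ_offset\<close> later removes the shift.\<close>
    have bound: "\<bar>(quad_map b ^^ (n + 2)) f $ k\<bar> \<le> q ^ Suc n" for n k
      using quad_map_funpow_contraction[OF assms(2) q(1) less_imp_le[OF q(2)] g, of n k]
      by (simp add: funpow_swap1)
    have "(\<lambda>n. q ^ Suc n) \<longlonglongrightarrow> 0"
      using q by (intro LIMSEQ_Suc LIMSEQ_power_zero) simp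
    then have "(\<lambda>n. (quad_map b ^^ (n + 2)) f $ k) \<longlonglongrightarrow> 0" for k
      by (rule Lim_null_comparison[rotated]) (use bound in \<open>simp del: power_Suc\<close>)
    then have "(\<lambda>n. (quad_map b ^^ (n + 2)) f) \<longlonglongrightarrow> 0"
      by (intro vec_tendstoI) simp
    then show ?thesis by (rule LIMSEQ_offset)
  qed
  \<comment> \<open>The orbit of a fixed point is constant, so its limit 0 is the point
    itself.\<close>
  have "f = 0" if "f \<in> unit_ball3" "quad_map b f = f" for f
  proof -
    have "(quad_map b ^^ n) f = f" for n
      using that(2) by (induction n) auto
    with lim[OF that(1)] show ?thesis by (simp add: LIMSEQ_const_iff)
  qed
  moreover have "quad_map b 0 = 0"
    by (simp add: quad_map_def vec_eq_iff)
  ultimately show ?thesis using lim by blast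
qed

end
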